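(* Let $\mathbf{2}^n$ denote the Boolean lattice of all subsets of $[n]=\{1,\dots,n\}$ ordered by inclusion. For every positive integer $n$, $\operatorname{ldim}(\mathbf{2}^n)\le n$, and for every integer $n\ge 2$, $$\frac{n}{2e\ln n}\ \le\ \operatorname{ldim}(\mathbf{2}^n).$$
   Context: Posets are finite and nonempty. A partial linear extension (ple) of a poset $\mathcal{P}=(P,\le)$ is a linear extension of a (nonempty) subposet of $\mathcal{P}$, i.e. a linear order on a nonempty subset $S\subseteq P$ that extends the order induced by $\mathcal{P}$ on $S$. A local realizer of $\mathcal{P}$ is a non-empty family $\mathcal{L}$ of ple's of $\mathcal{P}$ such that (i) if $x<y$ in $\mathcal{P}$, then some $L\in\mathcal{L}$ contains $x,y$ with $x<y$ in $L$; (ii) if $x$ and $y$ are incomparable in $\mathcal{P}$, then there are $L,L'\in\mathcal{L}$ with $x<y$ in $L$ and $x>y$ in $L'$. For $x\in P$, the frequency $\mu(x,\mathcal{L})$ is the number of ple's in $\mathcal{L}$ containing $x$, and $\mu(\mathcal{L})=\max_{x\in P}\mu(x,\mathcal{L})$. The local dimension is $\operatorname{ldim}(\mathcal{P})=\min_{\mathcal{L}}\mu(\mathcal{L})$, the minimum over all local realizers $\mathcal{L}$ of $\mathcal{P}$. Here $e$ is the base of the natural logarithm $\ln$. *)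

theory Defs
  imports Complex_Main
begin

text \<open>
  A poset is a pair of a carrier \<open>P\<close> and a reflexive order relation \<open>r\<close> on it, with
  \<^term>\<open>partial_order_on P r\<close>, \<open>P\<close> finite and nonempty. Linear orders on a subset \<open>S\<close> are
  reflexive relations as well, so a partial linear extension \<open>L\<close> with ground set \<open>S\<close> is
  determined by the relation alone: \<open>S = Field L\<close>, and ``\<open>L\<close> contains \<open>x\<close>'' is \<open>x \<in> Field L\<close>.
\<close>

definition partial_linear_extension :: "'a set \<Rightarrow> 'a rel \<Rightarrow> 'a rel \<Rightarrow> bool" where
  "partial_linear_extension P r L \<longleftrightarrow>
     (\<exists>S. S \<noteq> {} \<and> S \<subseteq> P \<and> linear_order_on S L \<and> Restr r S \<subseteq> L)"

definition local_realizer :: "'a set \<Rightarrow> 'a rel \<Rightarrow> 'a rel set \<Rightarrow> bool" where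
  "local_realizer P r \<L> \<longleftrightarrow>
     \<L> \<noteq> {} \<and>
     (\<forall>L\<in>\<L>. partial_linear_extension P r L) \<and>
     (\<forall>x\<in>P. \<forall>y\<in>P. x \<noteq> y \<and> (x, y) \<in> r \<longrightarrow> (\<exists>L\<in>\<L>. (x, y) \<in> L)) \<and>
     (\<forall>x\<in>P. \<forall>y\<in>P. (x, y) \<notin> r \<and> (y, x) \<notin> r \<longrightarrow>
        (\<exists>L\<in>\<L>. \<exists>L'\<in>\<L>. (x, y) \<in> L \<and> (y, x) \<in> L'))"

definition frequency :: "'a \<Rightarrow> 'a rel set \<Rightarrow> nat" where
  "frequency x \<L> = card {L \<in> \<L>. x \<in> Field L}"

definition max_frequency :: "'a set \<Rightarrow> 'a rel set \<Rightarrow> nat" where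
  "max_frequency P \<L> = Max ((\<lambda>x. frequency x \<L>) ` P)"

text \<open>
  For a finite nonempty poset the minimum is over a nonempty set (\<open>local_realizer_exists\<close>
  below), and every local realizer is a finite set, so the cardinalities are genuine.
\<close>

definition ldim :: "'a set \<Rightarrow> 'a rel \<Rightarrow> nat" where
  "ldim P r = (LEAST k. \<exists>\<L>. local_realizer P r \<L> \<and> max_frequency P \<L> = k)"

definition boolean_carrier :: "nat \<Rightarrow> nat set set" where
  "boolean_carrier n = Pow {1..n}"

definition boolean_order :: "nat \<Rightarrow> nat set rel" where
  "boolean_order n = {(A, B). A \<in> boolean_carrier n \<and> B \<in> boolean_carrier n \<and> A \<subseteq> B}"

lemma boolean_lattice_poset:
  "finite (boolean_carrier n)" "boolean_carrier n \<noteq> {}"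
  "partial_order_on (boolean_carrier n) (boolean_order n)"
  by (auto simp: boolean_carrier_def boolean_order_def partial_order_on_def preorder_on_def
      refl_on_def trans_def antisym_def)

lemma partial_linear_extension_iff_Field:
  "partial_linear_extension P r L \<longleftrightarrow>
     Field L \<noteq> {} \<and> Field L \<subseteq> P \<and> Linear_order L \<and> Restr r (Field L) \<subseteq> L"
proof -
  have "Field L = S" if "linear_order_on S L" for S
    using that by (auto simp: order_on_defs refl_on_def Field_def)
  then show ?thesis unfolding partial_linear_extension_def by metis
qed

lemma local_realizer_finite:
  assumes "finite P" "local_realizer P r \<L>"
  shows "finite \<L>"
proof (rule finite_subset)
  show "\<L> \<subseteq> Pow (P \<times> P)"
  proof
    fix L assume "L \<in> \<L>"
    then have "partial_linear_extension P r L" using assms(2) by (auto simp: local_realizer_def)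
    then have "Field L \<subseteq> P" by (simp add: partial_linear_extension_iff_Field)
    then show "L \<in> Pow (P \<times> P)" by (auto simp: Field_def)
  qed
qed (use assms(1) in simp)

lemma local_realizer_exists:
  assumes "P \<noteq> {}" "partial_order_on P r"
  shows "\<exists>\<L>. local_realizer P r \<L>"
proof -
  define C where "C x y = {(x, x), (y, y), (x, y)}" for x y :: 'a
  define \<L> where "\<L> = (\<lambda>(x, y). C x y) ` {(x, y). x \<in> P \<and> y \<in> P \<and> (x = y \<or> (y, x) \<notin> r)}"
  have ple: "partial_linear_extension P r (C x y)"
    if "x \<in> P" "y \<in> P" "x = y \<or> (y, x) \<notin> r" for x y
  proof -
    have "linear_order_on {x, y} (C x y)"
      unfolding C_def order_on_defs refl_on_def trans_def antisym_def total_on_def by blast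
    moreover have "Restr r {x, y} \<subseteq> C x y" using that(3) unfolding C_def by blast
    ultimately show ?thesis
      unfolding partial_linear_extension_def using that by (intro exI[of _ "{x, y}"]) simp
  qed
  have pair: "\<exists>L\<in>\<L>. (x, y) \<in> L" if "x \<in> P" "y \<in> P" "(y, x) \<notin> r" for x y
  proof
    show "C x y \<in> \<L>" using that unfolding \<L>_def by blast
    show "(x, y) \<in> C x y" by (simp add: C_def)
  qed
  have asym: "(y, x) \<notin> r" if "x \<noteq> y" "(x, y) \<in> r" for x y
    using that assms(2) unfolding partial_order_on_def antisym_def by blast
  have "local_realizer P r \<L>"
    unfolding local_realizer_def
  proof (intro conjI ballI impI)
    show "\<L> \<noteq> {}" using assms(1) unfolding \<L>_def by blast
    show "partial_linear_extension P r L" if "L \<in> \<L>" for L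
      using that ple unfolding \<L>_def by auto
    show "\<exists>L\<in>\<L>. (x, y) \<in> L" if "x \<in> P" "y \<in> P" "x \<noteq> y \<and> (x, y) \<in> r" for x y
      using that pair asym by blast
    show "\<exists>L\<in>\<L>. \<exists>L'\<in>\<L>. (x, y) \<in> L \<and> (y, x) \<in> L'"
      if "x \<in> P" "y \<in> P" "(x, y) \<notin> r \<and> (y, x) \<notin> r" for x y
      using pair[OF that(1,2)] pair[OF that(2,1)] that(3) by blast
  qed
  then show ?thesis by blast
qed

end

theory Submission
  imports Defs "HOL-Library.Nat_Bijection"
begin

text \<open>
  Upper bound: for each \<open>i\<close>, take a linear extension that puts all sets avoiding \<open>i\<close> below all
  sets containing \<open>i\<close>; it reverses every pair \<open>A, B\<close> with \<open>i \<in> A - B\<close>.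

  Lower bound: given a local realizer of maximum frequency \<open>d\<close>, a set \<open>A\<close> is determined by the
  pairs \<open>A < {i}\<close> occurring in its partial linear extensions, since these occur exactly for
  \<open>i \<notin> A\<close>. In one extension the elements \<open>i\<close> with \<open>{i}\<close> above \<open>A\<close> form a final segment of the
  singletons of that extension. As each singleton lies in at most \<open>d\<close> extensions, there are at
  most \<open>n d\<close> nonempty final segments altogether, and the complement of \<open>A\<close> is the union of at
  most \<open>d\<close> of them. Hence \<open>2 ^ n \<le> (n d + 1) ^ d\<close>.
\<close>

section \<open>Local realizers and local dimension\<close>

lemma frequency_le_max_frequency:
  assumes "finite P" "x \<in> P"
  shows "frequency x \<L> \<le> max_frequency P \<L>"
  using assms unfolding max_frequency_def by simp

lemma max_frequency_le_card:
  assumes "finite P" "P \<noteq> {}" "finite \<L>"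
  shows "max_frequency P \<L> \<le> card \<L>"
  using assms unfolding max_frequency_def frequency_def by (auto intro!: card_mono)

lemma ldim_le_max_frequency:
  assumes "local_realizer P r \<L>"
  shows "ldim P r \<le> max_frequency P \<L>"
  unfolding ldim_def by (rule Least_le) (use assms in blast)

lemma ldim_attained:
  assumes "P \<noteq> {}" "partial_order_on P r"
  obtains \<L> where "local_realizer P r \<L>" "max_frequency P \<L> = ldim P r"
proof -
  obtain \<L>\<^sub>0 where "local_realizer P r \<L>\<^sub>0"
    using local_realizer_exists[OF assms] by blast
  then have "\<exists>k \<L>. local_realizer P r \<L> \<and> max_frequency P \<L> = k"
    by blast
  from LeastI_ex[OF this] that show thesis
    unfolding ldim_def by blast
qed

section \<open>The upper bound\<close>

text \<open>Within the sets avoiding \<open>i\<close>, and within those containing it, the binary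
  code \<open>set_encode\<close> decides. It is injective on finite sets, which gives antisymmetry,
  and monotone under inclusion, which makes the order an extension.\<close>

definition coordinate_extension :: "nat \<Rightarrow> nat \<Rightarrow> nat set rel" where
  "coordinate_extension n i = {(A, B). A \<in> boolean_carrier n \<and> B \<in> boolean_carrier n \<and>
     (i \<notin> A \<and> i \<in> B \<or> (i \<in> A \<longleftrightarrow> i \<in> B) \<and> set_encode A \<le> set_encode B)}"

lemma finite_boolean_member: "A \<in> boolean_carrier n \<Longrightarrow> finite A"
  unfolding boolean_carrier_def by (auto intro: finite_subset)

lemma coordinate_extension_linear:
  "linear_order_on (boolean_carrier n) (coordinate_extension n i)"
  unfolding order_on_defs
proof (intro conjI)
  show "antisym (coordinate_extension n i)"
    unfolding antisym_def coordinate_extension_def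
    by (auto dest!: finite_boolean_member simp: set_encode_eq)
qed (auto simp: coordinate_extension_def refl_on_def trans_def total_on_def)

lemma coordinate_extension_ple:
  "partial_linear_extension (boolean_carrier n) (boolean_order n) (coordinate_extension n i)"
proof -
  have "set_encode A \<le> set_encode B" if "A \<subseteq> B" "B \<in> boolean_carrier n" for A B
    unfolding set_encode_def using that finite_boolean_member by (intro sum_mono2) auto
  then have "Restr (boolean_order n) (boolean_carrier n) \<subseteq> coordinate_extension n i"
    unfolding boolean_order_def coordinate_extension_def by auto
  then show ?thesis
    unfolding partial_linear_extension_def
    using coordinate_extension_linear boolean_lattice_poset(2)
    by (intro exI[of _ "boolean_carrier n"]) simp
qed

text \<open>If \<open>A\<close> is not contained in \<open>B\<close>, any \<open>i\<close> in
  \<open>A - B\<close> puts \<open>B\<close> below \<open>A\<close>. Both realizer conditions are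
  instances: a strict inclusion fails in reverse, and incomparability fails both ways. The family is
  nonempty because \<open>n \<ge> 1\<close>.\<close>

lemma coordinate_extensions_realizer:
  assumes "n \<ge> 1"
  shows "local_realizer (boolean_carrier n) (boolean_order n) (coordinate_extension n ` {1..n})"
proof -
  have reversed: "\<exists>L\<in>coordinate_extension n ` {1..n}. (B, A) \<in> L"
    if AB: "A \<in> boolean_carrier n" "B \<in> boolean_carrier n" "(A, B) \<notin> boolean_order n" for A B
  proof -
    obtain i where i: "i \<in> A" "i \<notin> B"
      using AB unfolding boolean_order_def by blast
    then have "i \<in> {1..n}"
      using AB(1) unfolding boolean_carrier_def by auto
    moreover have "(B, A) \<in> coordinate_extension n i"
      using AB i unfolding coordinate_extension_def by simp
    ultimately show ?thesis by blast
  qed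
  show ?thesis
    unfolding local_realizer_def
  proof (intro conjI ballI impI)
    show "coordinate_extension n ` {1..n} \<noteq> {}"
      using assms by simp
    show "partial_linear_extension (boolean_carrier n) (boolean_order n) L"
      if "L \<in> coordinate_extension n ` {1..n}" for L
      using that coordinate_extension_ple by auto
    show "\<exists>L\<in>coordinate_extension n ` {1..n}. (A, B) \<in> L"
      if "A \<in> boolean_carrier n" "B \<in> boolean_carrier n" "A \<noteq> B \<and> (A, B) \<in> boolean_order n" for A B
    proof -
      have "(B, A) \<notin> boolean_order n"
        using that(3) unfolding boolean_order_def by auto
      then show ?thesis by (rule reversed[OF that(2,1)])
    qed
    show "\<exists>L\<in>coordinate_extension n ` {1..n}. \<exists>L'\<in>coordinate_extension n ` {1..n}.
        (A, B) \<in> L \<and> (B, A) \<in> L'"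
      if "A \<in> boolean_carrier n" "B \<in> boolean_carrier n"
        "(A, B) \<notin> boolean_order n \<and> (B, A) \<notin> boolean_order n" for A B
      using reversed[OF that(1,2)] reversed[OF that(2,1)] that(3) by blast
  qed
qed

lemma ldim_boolean_le:
  assumes "n \<ge> 1"
  shows "ldim (boolean_carrier n) (boolean_order n) \<le> n"
proof -
  have "ldim (boolean_carrier n) (boolean_order n)
      \<le> max_frequency (boolean_carrier n) (coordinate_extension n ` {1..n})"
    by (rule ldim_le_max_frequency[OF coordinate_extensions_realizer[OF assms]])
  also have "\<dots> \<le> card (coordinate_extension n ` {1..n})"
    using boolean_lattice_poset by (intro max_frequency_le_card) auto
  also have "\<dots> \<le> n"
    using card_image_le[of "{1..n}" "coordinate_extension n"] by simp
  finally show ?thesis .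
qed

section \<open>The lower bound\<close>

lemma linear_order_finite_least:
  assumes "finite S" "S \<noteq> {}" "S \<subseteq> Field L" "Linear_order L"
  obtains m where "m \<in> S" "\<forall>x\<in>S. (m, x) \<in> L"
proof -
  have refl: "(x, x) \<in> L" if "x \<in> Field L" for x
    using assms(4) that unfolding order_on_defs refl_on_def by blast
  have total: "(x, y) \<in> L \<or> (y, x) \<in> L" if "x \<in> Field L" "y \<in> Field L" for x y
    using assms(4) that refl unfolding order_on_defs total_on_def by metis
  have trans: "(x, y) \<in> L \<Longrightarrow> (y, z) \<in> L \<Longrightarrow> (x, z) \<in> L" for x y z
    using assms(4) unfolding order_on_defs trans_def by blast
  from assms(1-3) have "\<exists>m\<in>S. \<forall>x\<in>S. (m, x) \<in> L"
  proof (induction S rule: finite_ne_induct)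
    case (singleton x)
    then show ?case using refl by simp
  next
    case (insert x S)
    then obtain m where m: "m \<in> S" "\<forall>y\<in>S. (m, y) \<in> L" by blast
    show ?case
      using total[of x m] refl[of x] m insert.prems trans by (metis insert_iff subset_iff)
  qed
  then show thesis using that by blast
qed

text \<open>Listing the members of \<open>S\<close> and padding with the empty set up to length
  exactly \<open>d\<close> leaves the union unchanged, so it suffices to count lists of length
  \<open>d\<close> over \<open>F\<close>.\<close>

lemma card_unions_le:
  assumes "finite F" "{} \<in> F"
  shows "card {\<Union>S |S. S \<subseteq> F \<and> card S \<le> d} \<le> card F ^ d"
proof -
  let ?W = "{xs. set xs \<subseteq> F \<and> length xs = d}"
  have "{\<Union>S |S. S \<subseteq> F \<and> card S \<le> d} \<subseteq> (\<lambda>xs. \<Union>(set xs)) ` ?W"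
  proof clarify
    fix S assume S: "S \<subseteq> F" "card S \<le> d"
    obtain xs where xs: "set xs = S" "distinct xs"
      using finite_distinct_list finite_subset[OF S(1) assms(1)] by blast
    let ?ys = "xs @ replicate (d - length xs) {}"
    have "length ?ys = d" using S(2) xs distinct_card by fastforce
    moreover have "set ?ys \<subseteq> F" "\<Union>(set ?ys) = \<Union>S" using S(1) xs assms(2) by auto
    ultimately show "\<Union>S \<in> (\<lambda>xs. \<Union>(set xs)) ` ?W" by blast
  qed
  moreover have "finite ?W" by (rule finite_lists_length_eq[OF assms(1)])
  ultimately have "card {\<Union>S |S. S \<subseteq> F \<and> card S \<le> d} \<le> card ?W"
    by (rule surj_card_le[rotated])
  then show ?thesis using card_lists_length_eq[OF assms(1)] by simp
qed

section \<open>Final segments of singletons\<close>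

text \<open>The relations are reflexive, so the condition \<open>A \<noteq> {i}\<close> makes the
  comparison strict; otherwise a singleton \<open>A\<close> would contribute its own
  element.\<close>

definition singletons_above :: "nat set rel \<Rightarrow> nat set \<Rightarrow> nat set" where
  "singletons_above L A = {i. A \<noteq> {i} \<and> (A, {i}) \<in> L}"

definition final_segment :: "nat set rel \<Rightarrow> nat \<Rightarrow> nat set" where
  "final_segment L m = {i. ({m}, {i}) \<in> L}"

lemma boolean_ple_in_carrier:
  assumes "partial_linear_extension (boolean_carrier n) (boolean_order n) L" "{i} \<in> Field L"
  shows "i \<in> {1..n}"
  using assms unfolding partial_linear_extension_iff_Field boolean_carrier_def by blast

text \<open>Take \<open>{m}\<close> to be the least singleton strictly above \<open>A\<close> in
  \<open>L\<close>. By transitivity every singleton from \<open>{m}\<close> on is above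
  \<open>A\<close>, and by antisymmetry none of them equals \<open>A\<close>.\<close>

lemma singletons_above_final_segment:
  assumes "partial_linear_extension (boolean_carrier n) (boolean_order n) L"
    and "singletons_above L A \<noteq> {}"
  obtains m where "{m} \<in> Field L" "singletons_above L A = final_segment L m"
proof -
  have lin: "Linear_order L"
    using assms(1) by (simp add: partial_linear_extension_iff_Field)
  then have trans: "trans L" and antisym: "antisym L"
    by (simp_all add: order_on_defs)
  let ?S = "(\<lambda>i. {i}) ` singletons_above L A"
  have field: "?S \<subseteq> Field L"
    unfolding singletons_above_def by (auto intro: FieldI2)
  then have "singletons_above L A \<subseteq> {1..n}"
    using boolean_ple_in_carrier[OF assms(1)] by blast
  then have "finite ?S"
    using finite_subset by blast
  then obtain M where M: "M \<in> ?S" "\<forall>x\<in>?S. (M, x) \<in> L"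
    by (rule linear_order_finite_least[OF _ _ field lin]) (use assms(2) in auto)
  then obtain m where m: "M = {m}" "m \<in> singletons_above L A" by blast
  have "singletons_above L A = final_segment L m"
  proof
    show "singletons_above L A \<subseteq> final_segment L m"
      using M m unfolding final_segment_def by blast
    show "final_segment L m \<subseteq> singletons_above L A"
      using m(2) transD[OF trans, of A "{m}"] antisymD[OF antisym, of A "{m}"]
      unfolding final_segment_def singletons_above_def by blast
  qed
  then show thesis using that m(2) field by blast
qed

lemma complement_eq_Union_singletons_above:
  assumes "local_realizer (boolean_carrier n) (boolean_order n) \<L>" "A \<in> boolean_carrier n"
  shows "{1..n} - A = (\<Union>L\<in>{L \<in> \<L>. A \<in> Field L}. singletons_above L A)"
proof
  show "{1..n} - A \<subseteq> (\<Union>L\<in>{L \<in> \<L>. A \<in> Field L}. singletons_above L A)"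
  proof
    fix i assume i: "i \<in> {1..n} - A"
    then have "{i} \<in> boolean_carrier n" "A \<noteq> {i}" "({i}, A) \<notin> boolean_order n"
      unfolding boolean_carrier_def boolean_order_def by auto
    \<comment> \<open>Either \<open>A\<close> is empty and strictly below \<open>{i}\<close>, or the
      two are incomparable; each realizer condition handles one case.\<close>
    then obtain L where "L \<in> \<L>" "(A, {i}) \<in> L"
      using assms unfolding local_realizer_def by metis
    with \<open>A \<noteq> {i}\<close> show "i \<in> (\<Union>L\<in>{L \<in> \<L>. A \<in> Field L}. singletons_above L A)"
      unfolding singletons_above_def by (auto intro: FieldI1)
  qed
next
  show "(\<Union>L\<in>{L \<in> \<L>. A \<in> Field L}. singletons_above L A) \<subseteq> {1..n} - A"
  proof clarify
    fix i L assume L: "L \<in> \<L>" "A \<in> Field L" and i: "i \<in> singletons_above L A"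
    have ple: "partial_linear_extension (boolean_carrier n) (boolean_order n) L"
      using assms(1) L(1) unfolding local_realizer_def by blast
    have above: "A \<noteq> {i}" "(A, {i}) \<in> L" "{i} \<in> Field L"
      using i unfolding singletons_above_def by (auto intro: FieldI2)
    have range: "i \<in> {1..n}"
      using boolean_ple_in_carrier[OF ple above(3)] .
    \<comment> \<open>An element \<open>i\<close> of \<open>A\<close> would give
      \<open>{i} \<subseteq> A\<close>, which \<open>L\<close> must respect, against
      \<open>A\<close> being strictly below \<open>{i}\<close> in \<open>L\<close>.\<close>
    have "i \<notin> A"
    proof
      assume "i \<in> A"
      then have "({i}, A) \<in> Restr (boolean_order n) (Field L)"
        using assms(2) above(3) L(2) unfolding boolean_order_def boolean_carrier_def by auto
      then have "({i}, A) \<in> L" "antisym L"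
        using ple unfolding partial_linear_extension_iff_Field order_on_defs by blast+
      then show False using above by (auto dest: antisymD)
    qed
    with range show "i \<in> {1..n} - A" by simp
  qed
qed

lemma power_le_of_boolean_local_realizer:
  assumes "local_realizer (boolean_carrier n) (boolean_order n) \<L>"
    and "max_frequency (boolean_carrier n) \<L> = d"
  shows "2 ^ n \<le> (n * d + 1) ^ d"
proof -
  have finL: "finite \<L>"
    using local_realizer_finite[OF boolean_lattice_poset(1) assms(1)] .
  have ple: "partial_linear_extension (boolean_carrier n) (boolean_order n) L" if "L \<in> \<L>" for L
    using assms(1) that unfolding local_realizer_def by blast
  have freq: "card {L \<in> \<L>. A \<in> Field L} \<le> d" if "A \<in> boolean_carrier n" for A
    using frequency_le_max_frequency[OF boolean_lattice_poset(1) that, of \<L>] assms(2)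
    unfolding frequency_def by simp
  \<comment> \<open>Segments are indexed by a singleton together with an extension containing it.
    Summing the frequencies of the \<open>n\<close> singletons bounds these pairs by
    \<open>n * d\<close>, however many extensions there are.\<close>
  define I where "I = (SIGMA m:{1..n}. {L \<in> \<L>. {m} \<in> Field L})"
  \<comment> \<open>The empty set covers extensions with no singleton above \<open>A\<close> and
    supplies the padding in \<open>card_unions_le\<close>; it accounts for the
    \<open>+ 1\<close>.\<close>
  define F where "F = insert {} ((\<lambda>(m, L). final_segment L m) ` I)"
  have finI: "finite I" unfolding I_def using finL by auto
  then have finF: "finite F" unfolding F_def by simp
  have "card I = (\<Sum>m\<in>{1..n}. card {L \<in> \<L>. {m} \<in> Field L})"
    unfolding I_def using finL by simp
  also have "\<dots> \<le> (\<Sum>m\<in>{1..n}. d)"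
    by (intro sum_mono freq) (auto simp: boolean_carrier_def)
  finally have "card I \<le> n * d" by simp
  then have cardF: "card F \<le> n * d + 1"
    using card_image_le[OF finI, of "\<lambda>(m, L). final_segment L m"]
      card_insert_le_m1[of "n * d + 1" "(\<lambda>(m, L). final_segment L m) ` I" "{}"]
    unfolding F_def by simp
  have inF: "singletons_above L A \<in> F" if L: "L \<in> \<L>" for L A
  proof (cases "singletons_above L A = {}")
    case False
    then obtain m where m: "{m} \<in> Field L" "singletons_above L A = final_segment L m"
      using singletons_above_final_segment[OF ple[OF L]] by blast
    then have "(m, L) \<in> I"
      using L boolean_ple_in_carrier[OF ple[OF L]] unfolding I_def by blast
    then show ?thesis using m(2) unfolding F_def by force
  qed (simp add: F_def)
  let ?U = "{\<Union>S |S. S \<subseteq> F \<and> card S \<le> d}"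
  \<comment> \<open>Complementation is injective on the carrier, so counting complements counts all
    \<open>2 ^ n\<close> sets.\<close>
  have "(\<lambda>A. {1..n} - A) ` boolean_carrier n \<subseteq> ?U"
  proof clarify
    fix A assume A: "A \<in> boolean_carrier n"
    let ?S = "(\<lambda>L. singletons_above L A) ` {L \<in> \<L>. A \<in> Field L}"
    have "card ?S \<le> d"
      using card_image_le[of "{L \<in> \<L>. A \<in> Field L}" "\<lambda>L. singletons_above L A"] finL freq[OF A]
      by simp
    moreover have "?S \<subseteq> F" using inF by blast
    moreover have "{1..n} - A = \<Union>?S"
      by (rule complement_eq_Union_singletons_above[OF assms(1) A])
    ultimately show "\<exists>S. {1..n} - A = \<Union>S \<and> S \<subseteq> F \<and> card S \<le> d" by blast
  qed
  moreover have "finite ?U"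
    by (rule finite_subset[of _ "Union ` Pow F"]) (use finF in auto)
  ultimately have "card ((\<lambda>A. {1..n} - A) ` boolean_carrier n) \<le> card ?U"
    by (intro card_mono)
  moreover have "inj_on (\<lambda>A. {1..n} - A) (boolean_carrier n)"
    unfolding boolean_carrier_def by (rule inj_onI) blast
  then have "card ((\<lambda>A. {1..n} - A) ` boolean_carrier n) = 2 ^ n"
    by (simp add: card_image boolean_carrier_def card_Pow)
  moreover have "card ?U \<le> card F ^ d"
    using card_unions_le[OF finF] unfolding F_def by blast
  moreover have "card F ^ d \<le> (n * d + 1) ^ d"
    using cardF by (rule power_mono) simp
  ultimately show ?thesis by linarith
qed

section \<open>From the counting inequality to the logarithmic bound\<close>

lemma half_le_ln_2: "1 / 2 \<le> ln (2 :: real)"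
proof -
  have "exp (1 / 2 :: real) ^ 2 = exp 1"
    by (simp add: power2_eq_square flip: exp_add)
  \<comment> \<open>The estimate \<open>exp 1 \<le> 3\<close> suffices.\<close>
  also have "\<dots> \<le> 2 ^ 2"
    using exp_le by simp
  finally have "exp (1 / 2 :: real) \<le> 2"
    by (rule power2_le_imp_le) simp
  then show ?thesis by (subst ln_ge_iff) auto
qed

text \<open>Since \<open>exp 1 \<ge> 2\<close>, it is enough to show
  \<open>n \<le> 4 * d * ln n\<close>. For \<open>d < n\<close> the base is at most
  \<open>n ^ 2\<close>, so logarithms give \<open>n * ln 2 \<le> 2 * d * ln n\<close>, and
  \<open>ln 2 \<ge> 1 / 2\<close> turns the factor 2 into 4.\<close>

lemma lower_bound_of_power_le:
  fixes n d :: nat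
  assumes "n \<ge> 2" and pow: "2 ^ n \<le> (n * d + 1) ^ d"
  shows "real n / (2 * exp 1 * ln (real n)) \<le> real d"
proof -
  have e: "exp (1::real) \<ge> 2"
    using exp_ge_add_one_self[of 1] by simp
  have "ln 2 \<le> ln (real n)"
    using assms(1) by simp
  then have lnn: "ln (real n) \<ge> 1 / 2"
    using half_le_ln_2 by linarith
  have denominator: "2 * exp 1 * ln (real n) \<ge> 4 * ln (real n)"
    using e lnn by (intro mult_right_mono) auto
  have "real n \<le> real d * (4 * ln (real n))"
  proof (cases "d \<ge> n")
    \<comment> \<open>Here \<open>4 * ln n \<ge> 2\<close>, so \<open>d \<ge> n\<close> is already
      enough and the counting inequality does not enter.\<close>
    case True
    then have "real n * 1 \<le> real d * (4 * ln (real n))"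
      using lnn by (intro mult_mono) auto
    then show ?thesis by simp
  next
    case False
    then have "n * d + 1 \<le> n * (n - 1) + 1"
      by simp
    also have "\<dots> \<le> n ^ 2"
      using assms(1) by (cases n) (auto simp: power2_eq_square)
    finally have "n * d + 1 \<le> n ^ 2" .
    then have "(n * d + 1) ^ d \<le> (n ^ 2) ^ d"
      by (rule power_mono) simp
    with pow have "2 ^ n \<le> n ^ (2 * d)"
      by (simp add: power_mult)
    then have "real (2 ^ n) \<le> real (n ^ (2 * d))"
      by (rule of_nat_mono)
    then have "ln (2 ^ n) \<le> ln (real n ^ (2 * d))"
      using assms(1) by (subst ln_le_cancel_iff) auto
    then have "real n * ln 2 \<le> 2 * real d * ln (real n)"
      using assms(1) by (simp add: ln_realpow)
    moreover have "real n * (1 / 2) \<le> real n * ln 2"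
      using half_le_ln_2 by (intro mult_left_mono) auto
    ultimately show ?thesis by simp
  qed
  also have "\<dots> \<le> real d * (2 * exp 1 * ln (real n))"
    using denominator by (intro mult_left_mono) auto
  finally show ?thesis
    using lnn by (simp add: divide_le_eq)
qed

lemma ldim_boolean_ge:
  assumes "n \<ge> 2"
  shows "real n / (2 * exp 1 * ln (real n)) \<le> real (ldim (boolean_carrier n) (boolean_order n))"
proof -
  obtain \<L> where "local_realizer (boolean_carrier n) (boolean_order n) \<L>"
    "max_frequency (boolean_carrier n) \<L> = ldim (boolean_carrier n) (boolean_order n)"
    using ldim_attained boolean_lattice_poset by metis
  then show ?thesis
    by (intro lower_bound_of_power_le[OF assms] power_le_of_boolean_local_realizer)
qed

theorem theorem5:
  shows "(\<forall>n::nat. n \<ge> 1 \<longrightarrow> ldim (boolean_carrier n) (boolean_order n) \<le> n) \<and>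
         (\<forall>n::nat. n \<ge> 2 \<longrightarrow>
            real n / (2 * exp 1 * ln (real n)) \<le> real (ldim (boolean_carrier n) (boolean_order n)))"
  using ldim_boolean_le ldim_boolean_ge by blast

end
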